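(* Let $n\geq 4$ be an integer and $S(n)=\langle f_n^2,f_{n+1}^2,f_{n+2}^2\rangle$. (1) If $f_n$ is even (that is, $n=3k$ with $k\geq 2$), then \[\mathrm{PF}(S(n)) = \left\{ (f_{n+1}-1)f_{n+1}^2 + \left(\tfrac{f_n}{2}-1\right)f_{n+2}^2 - f_n^2,\ \left(\tfrac{f_{n+3}}{2}-1\right)f_{n+1}^2 + (f_{n-2}-1)f_{n+2}^2 - f_n^2 \right\}.\] (2) If $f_{n+1}$ is even (that is, $n=3k-1$ with $k\geq 2$), then \[\mathrm{PF}(S(n)) = \left\{ \left(\tfrac{f_{n+1}}{2}-1\right)f_{n+1}^2 + \left(\tfrac{f_{n+1}}{2}-1\right)f_{n+2}^2 - f_n^2,\ (f_{n+2}-1)f_{n+1}^2 + \left(\tfrac{f_{n-2}}{2}-1\right)f_{n+2}^2 - f_n^2 \right\}.\] (3) If $f_{n+2}$ is even (that is, $n=3k-2$ with $k\geq 2$), then \[\mathrm{PF}(S(n)) = \left\{ \left(\tfrac{f_{n-1}}{2}-1\right)f_{n+1}^2 + (f_n-1)f_{n+2}^2 - f_n^2,\ \left(\tfrac{f_{n+2}}{2}-1\right)f_{n+1}^2 + \left(\tfrac{f_{n-2}+f_n}{2}-1\right)f_{n+2}^2 - f_n^2 \right\}.\]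
   Context: The Fibonacci numbers are defined by $f_0=0$, $f_1=1$, $f_k=f_{k-1}+f_{k-2}$ for $k\geq 2$. $\langle a_1,a_2,a_3\rangle$ denotes the set of all non-negative integer linear combinations of $a_1,a_2,a_3$; for $n\geq4$ this is a numerical semigroup (a submonoid of $(\mathbb{N},+)$ with finite complement). For a numerical semigroup $S$, an integer $x$ is a pseudo-Frobenius number of $S$ if $x\in\mathbb{Z}\setminus S$ and $x+s\in S$ for all $s\in S\setminus\{0\}$; $\mathrm{PF}(S)$ denotes the set of pseudo-Frobenius numbers of $S$. *)

theory Defs
  imports "HOL-Number_Theory.Number_Theory"
begin

definition numerical_semigroup :: "nat set \<Rightarrow> bool" where
  "numerical_semigroup S \<longleftrightarrow>
     0 \<in> S \<and> (\<forall>x\<in>S. \<forall>y\<in>S. x + y \<in> S) \<and> finite (UNIV - S)"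

definition generated3 :: "nat \<Rightarrow> nat \<Rightarrow> nat \<Rightarrow> nat set" where
  "generated3 a b c = {i * a + j * b + k * c | i j k. True}"

text \<open>Pseudo-Frobenius numbers are integers and may be negative: for \<open>S = UNIV\<close> the only one
  is \<open>-1\<close>. Hence the elements of \<open>S\<close> are embedded into the integers.\<close>

definition pseudo_frobenius :: "nat set \<Rightarrow> int set" where
  "pseudo_frobenius S = {x. x \<notin> int ` S \<and> (\<forall>s\<in>S - {0}. x + int s \<in> int ` S)}"

definition fib_square_semigroup :: "nat \<Rightarrow> nat set" where
  "fib_square_semigroup n = generated3 ((fib n)\<^sup>2) ((fib (n + 1))\<^sup>2) ((fib (n + 2))\<^sup>2)"

abbreviation ifib :: "nat \<Rightarrow> int" where
  "ifib k \<equiv> int (fib k)"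

lemma numerical_semigroup_generated3:
  assumes "coprime a b" "a > 0"
  shows "numerical_semigroup (generated3 a b c)"
proof -
  have "x \<in> generated3 a b c" if x: "x \<ge> a * b" for x
  proof -
    have "coprime b a" using assms(1) by (simp add: coprime_commute)
    then obtain u where "[b * u = 1] (mod a)" using cong_solve_coprime_nat[of b a] by auto
    then have "[b * u * x = 1 * x] (mod a)" by (rule cong_scalar_right)
    then obtain j where j: "[b * j = x] (mod a)"
      using that[of "u * x"] by (simp add: mult.assoc)
    define r where "r = j mod a"
    have "r < a" using assms(2) by (simp add: r_def)
    then have "r * b \<le> a * b" by simp
    then have le: "r * b \<le> x" using x by (rule order_trans)
    have "[r * b = x] (mod a)"
      using j by (simp add: r_def cong_def mod_simps mult.commute[of _ b])
    then have "a dvd x - r * b" using le cong_altdef_nat cong_sym by blast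
    then obtain i where "x - r * b = a * i" by (rule dvdE)
    then have "x = i * a + r * b + 0 * c" using le by (simp add: mult.commute)
    then show ?thesis unfolding generated3_def by blast
  qed
  then have "UNIV - generated3 a b c \<subseteq> {..<a * b}"
    by (auto simp: not_le[symmetric])
  then have "finite (UNIV - generated3 a b c)" by (rule finite_subset) simp
  moreover have "0 \<in> generated3 a b c"
  proof -
    have "0 = 0 * a + 0 * b + 0 * c" by simp
    then show ?thesis unfolding generated3_def by blast
  qed
  moreover have "x + y \<in> generated3 a b c"
    if xy: "x \<in> generated3 a b c" "y \<in> generated3 a b c" for x y
  proof -
    obtain i j k i' j' k' where "x = i * a + j * b + k * c" "y = i' * a + j' * b + k' * c"
      using xy unfolding generated3_def by blast
    then have "x + y = (i + i') * a + (j + j') * b + (k + k') * c"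
      by (simp add: algebra_simps)
    then show ?thesis unfolding generated3_def by blast
  qed
  ultimately show ?thesis unfolding numerical_semigroup_def by blast
qed

lemma numerical_semigroup_fib_square:
  assumes "n \<ge> 4"
  shows "numerical_semigroup (fib_square_semigroup n)"
  unfolding fib_square_semigroup_def
proof (rule numerical_semigroup_generated3)
  show "coprime ((fib n)\<^sup>2) ((fib (n + 1))\<^sup>2)"
    using coprime_fib_Suc_nat[of n] by simp
  show "(fib n)\<^sup>2 > 0" using assms by (simp add: fib_neq_0_nat)
qed

text \<open>All quotients by 2 in the formulas for the pseudo-Frobenius numbers of
  \<open>fib_square_semigroup n\<close> are exact in the parity case in which they occur, so that integer
  \<open>div\<close> involves no rounding.\<close>

lemma fib_halves_exact:
  assumes "n \<ge> 4"
  shows "even (ifib n) \<Longrightarrow> even (ifib (n + 3))"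
    and "even (ifib (n + 1)) \<Longrightarrow> even (ifib (n - 2))"
    and "even (ifib (n + 2)) \<Longrightarrow> even (ifib (n - 1))"
    and "even (ifib (n + 2)) \<Longrightarrow> even (ifib (n - 2) + ifib n)"
proof -
  obtain m where n: "n = m + 2" using that[of "n - 2"] assms by simp
  show "even (ifib n) \<Longrightarrow> even (ifib (n + 3))"
    "even (ifib (n + 1)) \<Longrightarrow> even (ifib (n - 2))"
    "even (ifib (n + 2)) \<Longrightarrow> even (ifib (n - 1))"
    "even (ifib (n + 2)) \<Longrightarrow> even (ifib (n - 2) + ifib n)"
    by (auto simp: n numeral_eq_Suc)
qed

end

(* Let a, b, c be the squares of x = fib n, y = fib (n + 1) and x + y.  There are explicit polynomial
   relations in x and y expressing a multiple of b in terms of a and c, and a multiple of c in terms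
   of a and b; their sum expresses a multiple of a in terms of b and c.  They reduce every
   element of the semigroup to i a + j b + k c with (j, k) in an L-shaped region containing exactly
   a lattice points.  As all residues modulo a occur, this normal form is unique, so it extends to
   all integers, with the semigroup given by i >= 0.  The pseudo-Frobenius numbers are then the
   integers with i = -1 whose point (j, k) is one of the two outer corners of the region. *)

theory Submission
  imports Defs
begin

section \<open>Normal forms over an L-shaped region\<close>

text \<open>The region is a \<open>p\<close> by \<open>r + s\<close> rectangle with a
  \<open>q\<close> by \<open>r\<close> rectangle attached to its right, and \<open>a_eq\<close> says
  that it has \<open>a\<close> points. The relations \<open>b_rel\<close> and \<open>c_rel\<close>
  trade points too far right or too high for a positive multiple of \<open>a\<close>.\<close>

locale l_shaped_semigroup =
  fixes a b c p q r s u v :: nat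
  assumes pos: "p > 0" "q > 0" "r > 0" "s > 0" "u > 0" "v > 0"
    and a_eq: "a = p * (r + s) + q * r"
    and b_rel: "(p + q) * b = u * a + s * c"
    and c_rel: "(r + s) * c = v * a + q * b"
    and coprime_ab: "coprime a b"
begin

definition S :: "nat set" where
  "S = generated3 a b c"

definition L :: "(nat \<times> nat) set" where
  "L = {..<p} \<times> {..<r + s} \<union> {p..<p + q} \<times> {..<r}"

lemma S_iff: "x \<in> S \<longleftrightarrow> (\<exists>i j k. x = i * a + j * b + k * c)"
  unfolding S_def generated3_def by blast

lemma L_iff: "(j, k) \<in> L \<longleftrightarrow> j < p \<and> k < r + s \<or> j < p + q \<and> k < r"
  unfolding L_def by auto

lemma a_pos: "a > 0"
  using pos a_eq by simp

lemma card_L: "card L = a"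
proof -
  have "card L = card ({..<p} \<times> {..<r + s}) + card ({p..<p + q} \<times> {..<r})"
    unfolding L_def by (rule card_Un_disjoint) auto
  then show ?thesis by (simp add: a_eq)
qed

text \<open>Adding \<open>b_rel\<close> and \<open>c_rel\<close> and cancelling
  \<open>q * b + s * c\<close> gives the relation that applies beyond the inner corner
  \<open>(p, r)\<close> of the region.\<close>

lemma a_rel: "p * b + r * c = (u + v) * a"
proof -
  have "(p + q) * b + (r + s) * c = (u * a + s * c) + (v * a + q * b)"
    using b_rel c_rel by simp
  then show ?thesis by (simp add: algebra_simps)
qed

text \<open>Each of the three relations splits off a positive multiple of \<open>a\<close>, so the
  value \<open>j * b + k * c\<close> of the remaining point strictly decreases; the induction is on
  this value.\<close>

lemma reduction:
  "\<exists>i j' k'. (j', k') \<in> L \<and> j * b + k * c = i * a + j' * b + k' * c"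
proof (induction "j * b + k * c" arbitrary: j k rule: less_induct)
  case less
  have step: ?case if eq: "j * b + k * c = w * a + j1 * b + k1 * c" and w: "w > 0" for w j1 k1
  proof -
    have "j1 * b + k1 * c < j * b + k * c" using eq w a_pos by simp
    from less[OF this] obtain i j' k' where
      *: "(j', k') \<in> L" "j1 * b + k1 * c = i * a + j' * b + k' * c" by blast
    then have "j * b + k * c = (w + i) * a + j' * b + k' * c"
      using eq by (simp add: algebra_simps)
    then show ?thesis using *(1) by blast
  qed
  \<comment> \<open>The complement of \<open>L\<close> is the union of the quadrants with apexes
    \<open>(p + q, 0)\<close>, \<open>(0, r + s)\<close> and \<open>(p, r)\<close>, one for each
    relation.\<close>
  have "(j, k) \<in> L \<or> p + q \<le> j \<or> r + s \<le> k \<or> p \<le> j \<and> r \<le> k"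
    unfolding L_iff by linarith
  then consider "(j, k) \<in> L" | "p + q \<le> j" | "r + s \<le> k" | "p \<le> j" "r \<le> k"
    by blast
  then show ?case
  proof cases
    case 1
    have "j * b + k * c = 0 * a + j * b + k * c" by simp
    then show ?thesis using 1 by blast
  next
    case 2
    then obtain j1 where "j = p + q + j1" using le_Suc_ex by blast
    then have "j * b + k * c = u * a + j1 * b + (s + k) * c"
      using b_rel by (simp add: algebra_simps)
    then show ?thesis using step pos by blast
  next
    case 3
    then obtain k1 where "k = r + s + k1" using le_Suc_ex by blast
    then have "j * b + k * c = v * a + (q + j) * b + k1 * c"
      using c_rel by (simp add: algebra_simps)
    then show ?thesis using step pos by blast
  next
    case 4
    then obtain j1 k1 where "j = p + j1" "k = r + k1" using le_Suc_ex[of p j] le_Suc_ex[of r k] by blast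
    then have "j * b + k * c = (u + v) * a + j1 * b + k1 * c"
      using a_rel by (simp add: algebra_simps)
    moreover have "u + v > 0" using pos by simp
    ultimately show ?thesis using step by blast
  qed
qed

text \<open>Since \<open>b\<close> is invertible modulo \<open>a\<close>, every residue is that of a
  multiple of \<open>b\<close>, and reducing this multiple into \<open>L\<close> changes it only by
  multiples of \<open>a\<close>.\<close>

lemma residue_in_L: "\<exists>(j, k)\<in>L. [j * b + k * c = m] (mod a)"
proof -
  have "coprime b a" using coprime_ab by (simp add: coprime_commute)
  then obtain w where "[b * w = 1] (mod a)" using cong_solve_coprime_nat by auto
  then have m: "[w * m * b + 0 * c = m] (mod a)"
    using cong_scalar_right[of "b * w" 1 a m] by (simp add: ac_simps)
  obtain i j k where jk: "(j, k) \<in> L" "w * m * b + 0 * c = i * a + j * b + k * c"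
    using reduction by blast
  then have "[j * b + k * c = w * m * b + 0 * c] (mod a)"
    by (simp add: cong_def add.assoc)
  then show ?thesis using jk(1) m cong_trans by blast
qed

text \<open>A map from the \<open>a\<close> points of \<open>L\<close> onto the \<open>a\<close>
  residues is injective. The exact size of \<open>L\<close> thus yields uniqueness of the normal
  form.\<close>

lemma residue_inj_on_L: "inj_on (\<lambda>(j, k). (j * b + k * c) mod a) L"
proof (rule eq_card_imp_inj_on)
  let ?f = "\<lambda>(j, k). (j * b + k * c) mod a"
  show "finite L" by (simp add: L_def)
  have "?f ` L = {..<a}"
  proof
    show "?f ` L \<subseteq> {..<a}" using a_pos by auto
    show "{..<a} \<subseteq> ?f ` L"
    proof
      fix m assume "m \<in> {..<a}"
      moreover obtain j k where "(j, k) \<in> L" "[j * b + k * c = m] (mod a)"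
        using residue_in_L by blast
      ultimately show "m \<in> ?f ` L" by (force simp: cong_def)
    qed
  qed
  then show "card (?f ` L) = card L" by (simp add: card_L)
qed

lemma normal_form:
  fixes x :: int
  obtains i j k where "(j, k) \<in> L" "x = i * int a + int (j * b + k * c)"
proof -
  define m where "m = nat (x mod int a)"
  have m: "int m = x mod int a" using a_pos by (simp add: m_def)
  obtain j k where jk: "(j, k) \<in> L" "[j * b + k * c = m] (mod a)"
    using residue_in_L by blast
  then have "[int (j * b + k * c) = int m] (mod int a)"
    by (simp only: cong_int_iff)
  then have "[x = int (j * b + k * c)] (mod int a)"
    unfolding m cong_def by simp
  then obtain i where "x - int (j * b + k * c) = int a * i"
    by (auto simp: cong_iff_dvd_diff elim: dvdE)
  then have "x = i * int a + int (j * b + k * c)" by (simp add: algebra_simps)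
  then show ?thesis using jk(1) that by blast
qed

text \<open>An element of \<open>S\<close> reduces to a normal form with non-negative coefficient of
  \<open>a\<close>; injectivity of residues on \<open>L\<close> identifies its point with
  \<open>(j, k)\<close>, and then the coefficients agree.\<close>

lemma mem_S_iff:
  assumes "(j, k) \<in> L"
  shows "i * int a + int (j * b + k * c) \<in> int ` S \<longleftrightarrow> i \<ge> 0"
proof
  assume "i \<ge> 0"
  then have "i * int a + int (j * b + k * c) = int (nat i * a + j * b + k * c)" by simp
  then show "i * int a + int (j * b + k * c) \<in> int ` S" using S_iff by blast
next
  assume "i * int a + int (j * b + k * c) \<in> int ` S"
  then obtain i0 j0 k0 where
    "i * int a + int (j * b + k * c) = int (i0 * a + j0 * b + k0 * c)"
    using S_iff by auto
  moreover obtain i1 j1 k1 where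
    *: "(j1, k1) \<in> L" "j0 * b + k0 * c = i1 * a + j1 * b + k1 * c"
    using reduction by blast
  ultimately have "i * int a + int (j * b + k * c) = int ((i0 + i1) * a + (j1 * b + k1 * c))"
    by (simp only: distrib_right add.assoc)
  then have eq: "i * int a + int (j * b + k * c) = int (i0 + i1) * int a + int (j1 * b + k1 * c)"
    by simp
  then have "int ((j * b + k * c) mod a) = int ((j1 * b + k1 * c) mod a)"
    by (metis add.commute mod_mult_self1 zmod_int)
  then have "(j, k) = (j1, k1)"
    using inj_onD[OF residue_inj_on_L, of "(j, k)" "(j1, k1)"] assms *(1) by simp
  then have "i * int a = int (i0 + i1) * int a" using eq by simp
  then show "i \<ge> 0" using a_pos by simp
qed

section \<open>Pseudo-Frobenius numbers and outer corners\<close>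

text \<open>It suffices to test the generators: a nonzero element of \<open>S\<close> contains at
  least one of them, and adding the rest does not leave \<open>S\<close>.\<close>

lemma pseudo_frobenius_iff:
  "x \<in> pseudo_frobenius S \<longleftrightarrow>
    x \<notin> int ` S \<and> x + int a \<in> int ` S \<and> x + int b \<in> int ` S \<and> x + int c \<in> int ` S"
proof
  \<comment> \<open>The definition quantifies over nonzero elements only, so the generators must be
    known to be nonzero.\<close>
  have pos_bc: "b > 0" "c > 0"
  proof -
    show "b > 0" using b_rel pos a_pos by (intro gr0I) auto
    show "c > 0" using c_rel pos a_pos by (intro gr0I) auto
  qed
  have "1 * a + 0 * b + 0 * c = a" "0 * a + 1 * b + 0 * c = b" "0 * a + 0 * b + 1 * c = c"
    by simp_all
  then have "a \<in> S" "b \<in> S" "c \<in> S" unfolding S_iff by metis+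
  moreover assume "x \<in> pseudo_frobenius S"
  ultimately show
    "x \<notin> int ` S \<and> x + int a \<in> int ` S \<and> x + int b \<in> int ` S \<and> x + int c \<in> int ` S"
    using a_pos pos_bc unfolding pseudo_frobenius_def by auto
next
  assume x: "x \<notin> int ` S \<and> x + int a \<in> int ` S \<and> x + int b \<in> int ` S \<and> x + int c \<in> int ` S"
  have add: "z + int (i * a + j * b + k * c) \<in> int ` S" if z: "z \<in> int ` S" for z i j k
  proof -
    obtain i' j' k' where "z = int (i' * a + j' * b + k' * c)" using z S_iff by auto
    then have "z + int (i * a + j * b + k * c)
      = int ((i' + i) * a + (j' + j) * b + (k' + k) * c)" by (simp add: algebra_simps)
    then show ?thesis using S_iff by blast
  qed
  have "x + int t \<in> int ` S" if t: "t \<in> S - {0}" for t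
  proof -
    obtain i j k where ijk: "t = i * a + j * b + k * c" using t S_iff by blast
    then have "i > 0 \<or> j > 0 \<or> k > 0" using t by auto
    then consider i' where "i = Suc i'" | j' where "j = Suc j'" | k' where "k = Suc k'"
      using gr0_implies_Suc by blast
    then show ?thesis
    proof cases
      case 1
      then show ?thesis using add[of "x + int a" i' j k] x by (simp add: ijk algebra_simps)
    next
      case 2
      then show ?thesis using add[of "x + int b" i j' k] x by (simp add: ijk algebra_simps)
    next
      case 3
      then show ?thesis using add[of "x + int c" i j k'] x by (simp add: ijk algebra_simps)
    qed
  qed
  then show "x \<in> pseudo_frobenius S" using x unfolding pseudo_frobenius_def by blast
qed

lemma corner_cases:
  assumes "(j, k) \<in> L" "(Suc j, k) \<notin> L" "(j, Suc k) \<notin> L"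
  shows "Suc j = p \<and> Suc k = r + s \<or> Suc j = p + q \<and> Suc k = r"
  using assms unfolding L_iff by auto

text \<open>A step right or up from an outer corner leaves \<open>L\<close>, so some relation
  releases a positive multiple of \<open>a\<close>, which makes up for the missing copy.\<close>

lemma corner_pseudo_frobenius:
  assumes "Suc j = p \<and> Suc k = r + s \<or> Suc j = p + q \<and> Suc k = r"
  shows "int (j * b + k * c) - int a \<in> pseudo_frobenius S"
proof -
  define x where "x = int (j * b + k * c) - int a"
  have L: "(j, k) \<in> L" using assms unfolding L_iff by auto
  have x: "x = (-1) * int a + int (j * b + k * c)" by (simp add: x_def)
  then have "x \<notin> int ` S" using mem_S_iff[OF L, of "-1"] by simp
  moreover have "x + int a \<in> int ` S" using mem_S_iff[OF L, of 0] by (simp add: x_def)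
  moreover have mem: "y \<in> int ` S"
    if eq: "y + int a = int (w * a + j' * b + k' * c)" and w: "w > 0" for y w j' k'
  proof -
    obtain w' where "w = Suc w'" using w gr0_implies_Suc by blast
    then have "y = int (w' * a + j' * b + k' * c)" using eq by simp
    then show ?thesis using S_iff by blast
  qed
  have xb: "x + int b + int a = int (Suc j * b + k * c)"
    and xc: "x + int c + int a = int (j * b + Suc k * c)" by (simp_all add: x_def)
  have "x + int b \<in> int ` S \<and> x + int c \<in> int ` S"
    using assms
  proof (elim disjE conjE)
    assume j: "Suc j = p" and k: "Suc k = r + s"
    \<comment> \<open>The point right of this corner lies beyond the inner corner, where
      \<open>a_rel\<close> applies; the point above it calls for \<open>c_rel\<close>.\<close>
    have "k = r + (s - 1)" using k pos by simp
    then have "Suc j * b + k * c = (u + v) * a + 0 * b + (s - 1) * c"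
      using a_rel j by (simp add: algebra_simps)
    moreover have "j * b + Suc k * c = v * a + (q + j) * b + 0 * c"
      using c_rel k by (simp add: algebra_simps)
    ultimately show ?thesis using mem xb xc pos by (metis add_gr_0)
  next
    assume j: "Suc j = p + q" and k: "Suc k = r"
    \<comment> \<open>Mirror image: the point above lies beyond the inner corner, and the point to
      the right calls for \<open>b_rel\<close>.\<close>
    have "j = p + (q - 1)" using j pos by simp
    then have "j * b + Suc k * c = (u + v) * a + (q - 1) * b + 0 * c"
      using a_rel k by (simp add: algebra_simps)
    moreover have "Suc j * b + k * c = u * a + 0 * b + (s + k) * c"
      using b_rel j by (simp add: algebra_simps)
    ultimately show ?thesis using mem xb xc pos by (metis add_gr_0)
  qed
  ultimately show ?thesis unfolding pseudo_frobenius_iff x_def by blast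
qed

theorem pseudo_frobenius_eq:
  "pseudo_frobenius (generated3 a b c) =
    {(int p - 1) * int b + (int (r + s) - 1) * int c - int a,
     (int (p + q) - 1) * int b + (int r - 1) * int c - int a}" (is "_ = {?x, ?y}")
proof -
  have corner_val: "int (j * b + k * c) - int a = ?x" if "Suc j = p \<and> Suc k = r + s" for j k
  proof -
    have "int p = int j + 1" "int (r + s) = int k + 1" using that by linarith+
    then show ?thesis by simp
  qed
  have corner_val': "int (j * b + k * c) - int a = ?y" if "Suc j = p + q \<and> Suc k = r" for j k
  proof -
    have "int (p + q) = int j + 1" "int r = int k + 1" using that by linarith+
    then show ?thesis by simp
  qed
  have "x \<in> {?x, ?y}" if x: "x \<in> pseudo_frobenius S" for x
  proof -
    obtain i j k where L: "(j, k) \<in> L" and xi: "x = i * int a + int (j * b + k * c)"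
      by (rule normal_form)
    have xa: "x + int a = (i + 1) * int a + int (j * b + k * c)"
      and xb: "x + int b = i * int a + int (Suc j * b + k * c)"
      and xc: "x + int c = i * int a + int (j * b + Suc k * c)"
      by (simp_all add: xi algebra_simps)
    have S: "x \<notin> int ` S" "x + int a \<in> int ` S" "x + int b \<in> int ` S" "x + int c \<in> int ` S"
      using x pseudo_frobenius_iff by auto
    have "i < 0" using S(1) mem_S_iff[OF L, of i] xi by simp
    moreover have "i + 1 \<ge> 0" using S(2) mem_S_iff[OF L, of "i + 1"] xa by simp
    ultimately have i: "i = -1" by simp
    \<comment> \<open>If the neighbour were in \<open>L\<close>, then \<open>x + int b\<close> would
      be in normal form with coefficient -1 and hence outside \<open>S\<close>.\<close>
    have "(Suc j, k) \<notin> L" using S(3) mem_S_iff[of "Suc j" k i] xb i by force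
    moreover have "(j, Suc k) \<notin> L" using S(4) mem_S_iff[of j "Suc k" i] xc i by force
    ultimately have "Suc j = p \<and> Suc k = r + s \<or> Suc j = p + q \<and> Suc k = r"
      using L corner_cases by blast
    moreover have "x = int (j * b + k * c) - int a" using xi i by simp
    ultimately show ?thesis using corner_val corner_val' by blast
  qed
  moreover have "?x \<in> pseudo_frobenius S"
    using corner_pseudo_frobenius[of "p - 1" "r + s - 1"] corner_val[of "p - 1" "r + s - 1"] pos
    by simp
  moreover have "?y \<in> pseudo_frobenius S"
    using corner_pseudo_frobenius[of "p + q - 1" "r - 1"] corner_val'[of "p + q - 1" "r - 1"] pos
    by simp
  ultimately show ?thesis unfolding S_def by blast
qed

end

section \<open>Parity of Fibonacci numbers\<close>

text \<open>Since \<open>fib 3 = 2\<close>, this is the identity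
  \<open>fib (gcd 3 n) = gcd (fib 3) (fib n)\<close>; the other possible gcd, 1, has Fibonacci
  number 1.\<close>

lemma even_fib_iff: "even (fib n) \<longleftrightarrow> 3 dvd n"
proof -
  have "fib 3 = 2" by (simp add: numeral_eq_Suc)
  then have "even (fib n) \<longleftrightarrow> gcd (fib 3) (fib n) = 2"
    by (simp only: gcd_nat.absorb_iff1[of 2 "fib n"])
  also have "\<dots> \<longleftrightarrow> fib (gcd 3 n) = fib 3"
    using \<open>fib 3 = 2\<close> by (simp only: fib_gcd)
  also have "\<dots> \<longleftrightarrow> gcd 3 n = 3"
  proof
    assume eq: "fib (gcd 3 n) = fib 3"
    have "gcd 3 n dvd 3" by simp
    moreover have "prime (3 :: nat)" by simp
    ultimately have "gcd 3 n = 1 \<or> gcd 3 n = 3" by (metis prime_nat_iff)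
    then show "gcd 3 n = 3" using eq \<open>fib 3 = 2\<close> by auto
  qed simp
  also have "\<dots> \<longleftrightarrow> 3 dvd n" by (rule gcd_nat.absorb_iff1[symmetric])
  finally show ?thesis .
qed

section \<open>The three parity cases as L-shaped semigroups\<close>

text \<open>In the application \<open>r = fib (n - 2)\<close> and
  \<open>s = fib (n - 3) div 2\<close>. Writing \<open>x\<close> and \<open>y\<close> in
  \<open>r\<close> and \<open>s\<close> removes all halves, and the relations become polynomial
  identities. The region has \<open>p = y\<close> and \<open>q = r + s\<close>, the half of
  \<open>x\<close>.\<close>

lemma pseudo_frobenius_squares_even_first:
  fixes x y r s :: nat
  assumes "x = 2 * (r + s)" "y = 3 * r + 4 * s" "r > 0" "s > 0" "coprime (x\<^sup>2) (y\<^sup>2)"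
  shows "pseudo_frobenius (generated3 (x\<^sup>2) (y\<^sup>2) ((x + y)\<^sup>2)) =
    {(int y - 1) * (int y)\<^sup>2 + (int (r + s) - 1) * (int x + int y)\<^sup>2 - (int x)\<^sup>2,
     (int (4 * r + 5 * s) - 1) * (int y)\<^sup>2 + (int r - 1) * (int x + int y)\<^sup>2 - (int x)\<^sup>2}"
proof -
  interpret l_shaped_semigroup "x\<^sup>2" "y\<^sup>2" "(x + y)\<^sup>2" y "r + s" r s
    "3 * (r + s) + 2 * y" "r + s + y"
    by unfold_locales (use assms in \<open>simp_all add: algebra_simps power2_eq_square\<close>)
  have "y + (r + s) = 4 * r + 5 * s" using assms by simp
  then show ?thesis using pseudo_frobenius_eq by simp
qed

text \<open>Here \<open>r\<close> stands for \<open>fib (n - 2) div 2\<close> and \<open>s\<close>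
  for \<open>fib (n - 1)\<close>; \<open>p\<close> is the half of \<open>y\<close>, and
  \<open>p + q\<close> is \<open>x + y\<close>.\<close>

lemma pseudo_frobenius_squares_even_second:
  fixes x y r s :: nat
  assumes "x = 2 * r + s" "y = 2 * (r + s)" "r > 0" "s > 0" "coprime (x\<^sup>2) (y\<^sup>2)"
  shows "pseudo_frobenius (generated3 (x\<^sup>2) (y\<^sup>2) ((x + y)\<^sup>2)) =
    {(int (r + s) - 1) * (int y)\<^sup>2 + (int (r + s) - 1) * (int x + int y)\<^sup>2 - (int x)\<^sup>2,
     (int (x + y) - 1) * (int y)\<^sup>2 + (int r - 1) * (int x + int y)\<^sup>2 - (int x)\<^sup>2}"
proof -
  interpret l_shaped_semigroup "x\<^sup>2" "y\<^sup>2" "(x + y)\<^sup>2" "r + s" "3 * r + 2 * s" r s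
    "x + y" "r + s"
    by unfold_locales (use assms in \<open>simp_all add: algebra_simps power2_eq_square\<close>)
  have "r + s + (3 * r + 2 * s) = x + y" using assms by simp
  then show ?thesis using pseudo_frobenius_eq by simp
qed

text \<open>Here \<open>s\<close> stands for \<open>fib (n - 1) div 2\<close> and \<open>r\<close>
  for \<open>(fib (n - 2) + fib n) div 2\<close>; \<open>p\<close> is \<open>s\<close>, and
  \<open>p + q\<close> is the half of \<open>x + y\<close>.\<close>

lemma pseudo_frobenius_squares_even_third:
  fixes x y r s :: nat
  assumes "x = r + s" "y = r + 3 * s" "r > 0" "s > 0" "coprime (x\<^sup>2) (y\<^sup>2)"
  shows "pseudo_frobenius (generated3 (x\<^sup>2) (y\<^sup>2) ((x + y)\<^sup>2)) =
    {(int s - 1) * (int y)\<^sup>2 + (int x - 1) * (int x + int y)\<^sup>2 - (int x)\<^sup>2,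
     (int (r + 2 * s) - 1) * (int y)\<^sup>2 + (int r - 1) * (int x + int y)\<^sup>2 - (int x)\<^sup>2}"
proof -
  interpret l_shaped_semigroup "x\<^sup>2" "y\<^sup>2" "(x + y)\<^sup>2" s x r s "r + 2 * s" "x + 2 * y"
    by unfold_locales (use assms in \<open>simp_all add: algebra_simps power2_eq_square\<close>)
  have "s + x = r + 2 * s" "r + s = x" using assms by simp_all
  then show ?thesis using pseudo_frobenius_eq
    by (simp only: of_nat_add of_nat_mult of_nat_power of_nat_numeral)
qed

section \<open>Specialisation to Fibonacci squares\<close>

theorem theorem5p15:
  fixes n :: nat
  assumes "n \<ge> 4"
  shows "((even (fib n) \<longleftrightarrow> (\<exists>k\<ge>2. n = 3 * k)) \<and>
          (even (fib n) \<longrightarrow>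
            pseudo_frobenius (fib_square_semigroup n) =
              {(ifib (n + 1) - 1) * (ifib (n + 1))\<^sup>2
                 + (ifib n div 2 - 1) * (ifib (n + 2))\<^sup>2 - (ifib n)\<^sup>2,
               (ifib (n + 3) div 2 - 1) * (ifib (n + 1))\<^sup>2
                 + (ifib (n - 2) - 1) * (ifib (n + 2))\<^sup>2 - (ifib n)\<^sup>2}))
       \<and> ((even (fib (n + 1)) \<longleftrightarrow> (\<exists>k\<ge>2. n = 3 * k - 1)) \<and>
          (even (fib (n + 1)) \<longrightarrow>
            pseudo_frobenius (fib_square_semigroup n) =
              {(ifib (n + 1) div 2 - 1) * (ifib (n + 1))\<^sup>2
                 + (ifib (n + 1) div 2 - 1) * (ifib (n + 2))\<^sup>2 - (ifib n)\<^sup>2,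
               (ifib (n + 2) - 1) * (ifib (n + 1))\<^sup>2
                 + (ifib (n - 2) div 2 - 1) * (ifib (n + 2))\<^sup>2 - (ifib n)\<^sup>2}))
       \<and> ((even (fib (n + 2)) \<longleftrightarrow> (\<exists>k\<ge>2. n = 3 * k - 2)) \<and>
          (even (fib (n + 2)) \<longrightarrow>
            pseudo_frobenius (fib_square_semigroup n) =
              {(ifib (n - 1) div 2 - 1) * (ifib (n + 1))\<^sup>2
                 + (ifib n - 1) * (ifib (n + 2))\<^sup>2 - (ifib n)\<^sup>2,
               (ifib (n + 2) div 2 - 1) * (ifib (n + 1))\<^sup>2
                 + ((ifib (n - 2) + ifib n) div 2 - 1) * (ifib (n + 2))\<^sup>2 - (ifib n)\<^sup>2}))"
proof -
  obtain m where n: "n = m + 4" using assms le_Suc_ex by (metis add.commute)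
  define x where "x = fib n"
  define y where "y = fib (n + 1)"
  have fibs: "fib (n + 2) = x + y" "fib (n + 3) = x + 2 * y" "y = fib (n - 1) + x"
    "x = fib (n - 1) + fib (n - 2)" "fib (n - 1) = fib (n - 2) + fib (n - 3)"
    "fib (n - 3) > 0" "fib (n - 2) > 0"
    by (simp_all add: x_def y_def n numeral_eq_Suc fib_neq_0_nat)
  \<comment> \<open>These say that \<open>fib (n - 1)\<close>, \<open>fib (n - 2)\<close> and
    \<open>fib (n - 3)\<close> are positive. They make \<open>r\<close> and \<open>s\<close>
    positive in every case and the natural subtractions below exact.\<close>
  then have ord: "x < y" "y < 2 * x" "3 * x < 2 * y" by auto
  have cop: "coprime (x\<^sup>2) (y\<^sup>2)"
    using coprime_fib_Suc_nat[of n] by (simp add: x_def y_def)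
  have ifibs: "ifib n = int x" "ifib (n + 1) = int y" "ifib (n + 2) = int x + int y"
    "ifib (n + 3) = int x + 2 * int y" "ifib (n - 1) = int y - int x"
    "ifib (n - 2) = 2 * int x - int y"
    using fibs by (simp_all add: x_def y_def)
  have semigroup: "fib_square_semigroup n = generated3 (x\<^sup>2) (y\<^sup>2) ((x + y)\<^sup>2)"
    unfolding fib_square_semigroup_def fibs(1) by (simp add: x_def y_def)
  \<comment> \<open>With \<open>n \<ge> 4\<close>, divisibility of \<open>n\<close>,
    \<open>n + 1\<close> or \<open>n + 2\<close> by 3 forces \<open>k \<ge> 2\<close>.\<close>
  have "even (fib n) \<longleftrightarrow> (\<exists>k\<ge>2. n = 3 * k)"
    "even (fib (n + 1)) \<longleftrightarrow> (\<exists>k\<ge>2. n = 3 * k - 1)"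
    "even (fib (n + 2)) \<longleftrightarrow> (\<exists>k\<ge>2. n = 3 * k - 2)"
    unfolding even_fib_iff using assms by presburger+
  moreover have "pseudo_frobenius (fib_square_semigroup n) =
      {(ifib (n + 1) - 1) * (ifib (n + 1))\<^sup>2
         + (ifib n div 2 - 1) * (ifib (n + 2))\<^sup>2 - (ifib n)\<^sup>2,
       (ifib (n + 3) div 2 - 1) * (ifib (n + 1))\<^sup>2
         + (ifib (n - 2) - 1) * (ifib (n + 2))\<^sup>2 - (ifib n)\<^sup>2}" if "even (fib n)"
  proof -
    obtain h where h: "x = 2 * h" using \<open>even (fib n)\<close> unfolding x_def by (rule evenE)
    \<comment> \<open>This and the next line solve \<open>x = 2 * (r + s)\<close> and
      \<open>y = 3 * r + 4 * s\<close>.\<close>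
    define s where "s = y - 3 * h"
    define r where "r = h - s"
    have rs: "x = 2 * (r + s)" "y = 3 * r + 4 * s" "r > 0" "s > 0"
      using ord h by (simp_all add: r_def s_def)
    have "int x div 2 = int (r + s)" "(int x + 2 * int y) div 2 = int (4 * r + 5 * s)"
      "2 * int x - int y = int r" using rs by simp_all
    then show ?thesis
      unfolding ifibs semigroup pseudo_frobenius_squares_even_first[OF rs cop] by (simp only:)
  qed
  moreover have "pseudo_frobenius (fib_square_semigroup n) =
      {(ifib (n + 1) div 2 - 1) * (ifib (n + 1))\<^sup>2
         + (ifib (n + 1) div 2 - 1) * (ifib (n + 2))\<^sup>2 - (ifib n)\<^sup>2,
       (ifib (n + 2) - 1) * (ifib (n + 1))\<^sup>2
         + (ifib (n - 2) div 2 - 1) * (ifib (n + 2))\<^sup>2 - (ifib n)\<^sup>2}" if "even (fib (n + 1))"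
  proof -
    obtain h where h: "y = 2 * h" using \<open>even (fib (n + 1))\<close> unfolding y_def by (rule evenE)
    define r where "r = x - h"
    define s where "s = h - r"
    have rs: "x = 2 * r + s" "y = 2 * (r + s)" "r > 0" "s > 0"
      using ord h by (simp_all add: r_def s_def)
    have "int y div 2 = int (r + s)" "(2 * int x - int y) div 2 = int r" using rs by simp_all
    then show ?thesis
      unfolding ifibs semigroup pseudo_frobenius_squares_even_second[OF rs cop]
      by (simp only: of_nat_add)
  qed
  moreover have "pseudo_frobenius (fib_square_semigroup n) =
      {(ifib (n - 1) div 2 - 1) * (ifib (n + 1))\<^sup>2
         + (ifib n - 1) * (ifib (n + 2))\<^sup>2 - (ifib n)\<^sup>2,
       (ifib (n + 2) div 2 - 1) * (ifib (n + 1))\<^sup>2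
         + ((ifib (n - 2) + ifib n) div 2 - 1) * (ifib (n + 2))\<^sup>2 - (ifib n)\<^sup>2}"
    if "even (fib (n + 2))"
  proof -
    have "even (x + y)" using that unfolding fibs(1) .
    \<comment> \<open>The difference \<open>y - x\<close> is \<open>fib (n - 1)\<close>, whose half
      is the required \<open>s\<close>.\<close>
    then have "even (y - x)" using ord by simp
    then obtain s where s: "y - x = 2 * s" by (rule evenE)
    define r where "r = x - s"
    have rs: "x = r + s" "y = r + 3 * s" "r > 0" "s > 0"
      using ord s by (simp_all add: r_def)
    have "(int y - int x) div 2 = int s" "(int x + int y) div 2 = int (r + 2 * s)"
      "(2 * int x - int y + int x) div 2 = int r" using rs by simp_all
    then show ?thesis
      unfolding ifibs semigroup pseudo_frobenius_squares_even_third[OF rs cop] by (simp only:)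
  qed
  ultimately show ?thesis by blast
qed

end
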